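(* For all integers $n\ge 0$, $$F(2n;0,n)=4^n\frac{(3/2)_n}{(2n+1)(2)_n}=\frac{4^n(1/2)_n}{(2)_n},$$ $$F(2n+2;0,n)=\frac{2^{2n+1}(n+1)(3/2)_n}{(3)_n},$$ $$F(2n+4;0,n)=\frac{4^n(n+1)(8n^2+32n+33)(3/2)_n}{3\,(4)_n},$$ $$F(2n+6;0,n)=\frac{4^{n-1}(n+1)(64n^4+672n^3+2648n^2+4641n+3060)(3/2)_n}{9\,(5)_n}.$$ More generally, for every integer $k\ge 0$ there is a function $r_k(n)$ such that for all integers $n\ge 0$ $$F(2n+2k;0,n)=4^n\frac{(3/2)_n}{(k+2)_n}\,r_k(n),$$ where $r_0(n)=\frac{1}{2n+1}$ and, for $k\ge 1$, $r_k(n)$ is a polynomial in $n$ of degree $2k-1$ divisible by $n+1$.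
   Context: For integers $m\ge 0$ and $n_1,n_2$, $F(m;n_1,n_2)$ denotes the number of Gessel walks with exactly $m$ steps from $(0,0)$ to $(n_1,n_2)$: lattice walks starting at the origin, each of whose $m$ steps is one of West $(-1,0)$, North-East $(1,1)$, East $(1,0)$, South-West $(-1,-1)$, and which remain in the first quadrant $\{(i,j): i\ge 0, j\ge 0\}$. In particular $F(m;n_1,n_2)=0$ if $n_1<0$ or $n_2<0$, and $F(0;n_1,n_2)=1$ if $n_1=n_2=0$ and $0$ otherwise. $(a)_n=a(a+1)\cdots(a+n-1)$ is the Pochhammer symbol, with $(a)_0=1$. *)

theory Defs
  imports Complex_Main "HOL-Library.Product_Plus" "HOL-Computational_Algebra.Polynomial"
begin

definition gessel_steps :: "(int \<times> int) set" where
  "gessel_steps = {(-1, 0), (1, 1), (1, 0), (-1, -1)}"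

(* A walk from the origin is given by its list w of steps; its successive positions are
   the partial sums of w. *)
definition gessel_walk :: "(int \<times> int) list \<Rightarrow> bool" where
  "gessel_walk w \<longleftrightarrow> set w \<subseteq> gessel_steps \<and>
     (\<forall>i\<le>length w. 0 \<le> fst (sum_list (take i w)) \<and> 0 \<le> snd (sum_list (take i w)))"

definition F :: "nat \<Rightarrow> int \<Rightarrow> int \<Rightarrow> nat" where
  "F m n\<^sub>1 n\<^sub>2 = card {w. gessel_walk w \<and> length w = m \<and> sum_list w = (n\<^sub>1, n\<^sub>2)}"

end

theory Submission
  imports Defs
begin

text \<open>Mark the East and South-West steps. Then the first coordinate is a Dyck-type path, the second
  one is the number of up steps (North-East, East) minus the number of marked steps, and a walk of
  length \<open>2N\<close> to \<open>(0, N - k)\<close> is a Dyck path of semilength \<open>N\<close> with \<open>k\<close> marked steps such that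
  marks never outnumber up steps. Without the last condition there are \<open>Cat\<^sub>N\<close> times
  \<open>2N choose k\<close> of these. A path violating it does so for the first time after fewer than \<open>k\<close> up
  steps, so the correction is a sum of boundedly many terms, each a constant times a ballot number
  times a binomial coefficient. For \<open>N = m + k - 1\<close> all terms are
  \<open>(2m)! / (m! (m + k)!)\<close> times a polynomial in \<open>m\<close>; the main term has degree \<open>2k - 1\<close> and the
  others have smaller degree. At \<open>m = 0\<close> the end point is \<open>(0, -1)\<close>, so the polynomial vanishes
  there, and \<open>m = n + 1\<close> gives the factor \<open>n + 1\<close>.\<close>

section \<open>Counting walks by their last step\<close>

lemma gessel_walk_snoc:
  "gessel_walk (w @ [s]) \<longleftrightarrow>
     gessel_walk w \<and> s \<in> gessel_steps \<and> 0 \<le> fst (sum_list w + s) \<and> 0 \<le> snd (sum_list w + s)"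
proof -
  have "(\<forall>i\<le>length (w @ [s]). P (take i (w @ [s]))) \<longleftrightarrow>
          (\<forall>i\<le>length w. P (take i w)) \<and> P (w @ [s])" for P
    by (auto simp: le_Suc_eq)
  from this[of "\<lambda>v. 0 \<le> fst (sum_list v) \<and> 0 \<le> snd (sum_list v)"]
  show ?thesis by (auto simp: gessel_walk_def)
qed

lemma gessel_walk_nonneg: "gessel_walk w \<Longrightarrow> 0 \<le> fst (sum_list w) \<and> 0 \<le> snd (sum_list w)"
  unfolding gessel_walk_def by (metis order_refl take_all_iff)

lemma finite_gessel_walks:
  "finite {w. gessel_walk w \<and> length w = m \<and> sum_list w = (i, j)}"
  by (rule finite_subset[OF _ finite_lists_length_eq[of gessel_steps m]])
     (auto simp: gessel_walk_def gessel_steps_def)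

lemma F_0: "F 0 i j = (if i = 0 \<and> j = 0 then 1 else 0)"
proof -
  have "{w. gessel_walk w \<and> length w = 0 \<and> sum_list w = (i, j)} = (if i = 0 \<and> j = 0 then {[]} else {})"
    by (auto simp: gessel_walk_def zero_prod_def)
  then show ?thesis by (auto simp: F_def)
qed

lemma F_neg: "i < 0 \<or> j < 0 \<Longrightarrow> F m i j = 0"
proof -
  assume "i < 0 \<or> j < 0"
  then have "{w. gessel_walk w \<and> length w = m \<and> sum_list w = (i, j)} = {}"
    using gessel_walk_nonneg by force
  then show ?thesis unfolding F_def by (simp only: card.empty)
qed

lemma F_Suc:
  "F (Suc m) i j = (if 0 \<le> i \<and> 0 \<le> j
     then F m (i + 1) j + F m (i - 1) (j - 1) + F m (i - 1) j + F m (i + 1) (j + 1) else 0)"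
proof (cases "0 \<le> i \<and> 0 \<le> j")
  case True
  define W where "W i j = {w. gessel_walk w \<and> length w = m \<and> sum_list w = (i, j)}" for i j
  define X where "X s = (\<lambda>w. w @ [s]) ` W (i - fst s) (j - snd s)" for s
  have *: "{w. gessel_walk w \<and> length w = Suc m \<and> sum_list w = (i, j)} = (\<Union>s\<in>gessel_steps. X s)"
    (is "?L = ?R")
  proof (intro equalityI subsetI)
    fix w assume "w \<in> ?L"
    moreover from this obtain v s where "w = v @ [s]"
      by (cases w rule: rev_cases) auto
    ultimately show "w \<in> ?R"
      by (cases s; cases "sum_list v") (force simp: X_def W_def gessel_walk_snoc)
  next
    fix w assume "w \<in> ?R"
    then show "w \<in> ?L"
      using True by (auto simp: X_def W_def gessel_walk_snoc)
  qed
  have "F (Suc m) i j = (\<Sum>s\<in>gessel_steps. card (X s))"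
    unfolding F_def * by (rule card_UN_disjoint)
      (auto simp: X_def W_def gessel_steps_def finite_gessel_walks)
  also have "\<dots> = (\<Sum>s\<in>gessel_steps. F m (i - fst s) (j - snd s))"
    unfolding X_def by (subst card_image) (auto simp: inj_on_def W_def F_def)
  finally show ?thesis
    using True by (simp add: gessel_steps_def)
next
  case False
  then show ?thesis using F_neg[of i j "Suc m"] by auto
qed

lemma F_far: "int m < i \<Longrightarrow> F m i j = 0"
  by (induction m arbitrary: i j) (auto simp: F_0 F_Suc)

section \<open>Binomial coefficients and ballot numbers\<close>

text \<open>An integer lower index, with value 0 at negative ones, lets Pascal's rule hold without
  side conditions.\<close>

definition bc :: "nat \<Rightarrow> int \<Rightarrow> int" where
  "bc s k = (if k < 0 then 0 else int (s choose nat k))"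

lemma bc_of_nat: "bc s (int k) = int (s choose k)"
  by (simp add: bc_def)

lemma bc_0: "bc 0 k = (if k = 0 then 1 else 0)"
  by (auto simp: bc_def)

lemma bc_Suc: "bc (Suc s) k = bc s k + bc s (k - 1)"
proof (cases "k \<le> 0")
  case True
  then show ?thesis by (auto simp: bc_def)
next
  case False
  then have "nat k = Suc (nat (k - 1))" by simp
  then show ?thesis using False by (simp add: bc_def del: Suc_nat_eq_nat_zadd1)
qed

lemma bc_symmetric: "bc s (int s - k) = bc s k"
proof -
  consider "k < 0" | "k > int s" | "0 \<le> k" "k \<le> int s" by linarith
  then show ?thesis
  proof cases
    case 3
    then have "nat (int s - k) = s - nat k" "nat k \<le> s" by auto
    then show ?thesis using 3 by (simp add: bc_def binomial_symmetric[of "nat k" s])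
  qed (auto simp: bc_def binomial_eq_0)
qed

text \<open>By the reflection principle this counts the \<open>\<plusminus>1\<close>-paths with \<open>s\<close> steps, \<open>u\<close> of them up,
  which start at height \<open>x\<close> and stay nonnegative, provided that the final height is at least \<open>-1\<close>.\<close>

definition ballot :: "int \<Rightarrow> nat \<Rightarrow> int \<Rightarrow> int" where
  "ballot x s u = bc s u - bc s (u + x + 1)"

lemma ballot_Suc: "ballot x (Suc s) u = ballot x s u + ballot x s (u - 1)"
  by (simp add: ballot_def bc_Suc algebra_simps)

text \<open>The final height is -1 here, so the two lower indices add up to
  \<open>s\<close>.\<close>

lemma ballot_eq_0: "x + 2 * u + 1 = int s \<Longrightarrow> ballot x s u = 0"
  using bc_symmetric[of s u]
  by (simp add: ballot_def)
    (metis add.commute add_diff_cancel_right' add.assoc mult_2)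

text \<open>Such paths end at height 0 after \<open>a\<close> up and \<open>b - 1\<close> down
  steps, so the reflected index \<open>a + x + 1\<close> is \<open>b\<close>.\<close>

lemma ballot_fact:
  assumes "a + b = Suc M" "0 < b" "x = int b - int a - 1"
  shows "(of_int (ballot x M (int a)) :: rat)
           = (of_nat b - of_nat a) * fact M / (fact a * fact b)"
proof -
  have 1: "of_nat (M choose a) * fact a * fact b = (of_nat b * fact M :: rat)"
  proof -
    obtain c where c: "b = Suc c" using assms by (cases b) auto
    then have "a \<le> M" "M - a = c" using assms by auto
    then show ?thesis using binomial_fact[of a M, where ?'a = rat] c by (simp add: field_simps)
  qed
  have 2: "of_nat (M choose b) * fact a * fact b = (of_nat a * fact M :: rat)"
  proof (cases a)
    case 0
    then show ?thesis using assms by (simp add: binomial_eq_0)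
  next
    case (Suc c)
    then have "b \<le> M" "M - b = c" using assms by auto
    then show ?thesis using binomial_fact[of b M, where ?'a = rat] Suc by (simp add: field_simps)
  qed
  have "int a + x + 1 = int b" using assms by simp
  then have "ballot x M (int a) = int (M choose a) - int (M choose b)"
    by (simp only: ballot_def bc_of_nat)
  then have "(of_int (ballot x M (int a)) :: rat) = of_nat (M choose a) - of_nat (M choose b)"
    by simp
  moreover have "of_nat (M choose a) = (of_nat b * fact M / (fact a * fact b) :: rat)"
    using 1 by (simp add: field_simps)
  moreover have "of_nat (M choose b) = (of_nat a * fact M / (fact a * fact b) :: rat)"
    using 2 by (simp add: field_simps)
  ultimately show ?thesis by (simp add: diff_divide_distrib left_diff_distrib)
qed

section \<open>Marked paths and their first exit\<close>

text \<open>Walks with \<open>m\<close> steps, \<open>u\<close> of them up and \<open>\<mu>\<close> of them marked.\<close>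

definition walks :: "nat \<Rightarrow> int \<Rightarrow> int \<Rightarrow> int" where
  "walks m u \<mu> = int (F m (2 * u - int m) (u - \<mu>))"

lemma walks_0: "walks 0 u \<mu> = (if u = 0 \<and> \<mu> = 0 then 1 else 0)"
  by (auto simp: walks_def F_0)

text \<open>The four terms stand for a last step West, South-West, North-East and East.\<close>

lemma walks_Suc:
  assumes "int (Suc m) \<le> 2 * u" "\<mu> \<le> u"
  shows "walks (Suc m) u \<mu> = walks m u \<mu> + walks m u (\<mu> - 1) + walks m (u - 1) \<mu> + walks m (u - 1) (\<mu> - 1)"
  using assms by (simp add: walks_def F_Suc algebra_simps)

lemma walks_eq_0: "2 * u < int m \<or> u < \<mu> \<or> int m < u \<Longrightarrow> walks m u \<mu> = 0"
  by (auto simp: walks_def F_neg F_far)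

text \<open>Pairs \<open>(v, t)\<close>: the second coordinate first becomes negative at time \<open>t\<close>, after \<open>v\<close> up
  steps and with the \<open>(v + 1)\<close>-st marked step.\<close>

definition exits :: "nat \<Rightarrow> (nat \<times> nat) set" where
  "exits k = (SIGMA v:{..<k}. {v<..2 * v})"

lemma finite_exits [simp]: "finite (exits k)"
  by (simp add: exits_def)

text \<open>For final heights \<open>2 * u - m\<close> from -1 on, this counts the paths with exit
  \<open>(v, t)\<close>: a walk to second coordinate 0 at time \<open>t - 1\<close>, the South-West
  exit step, then a nonnegative path from height \<open>2 * v - t\<close> with the remaining marks
  placed freely.\<close>

definition bad :: "nat \<Rightarrow> int \<Rightarrow> int \<Rightarrow> nat \<times> nat \<Rightarrow> int" where
  "bad m u \<mu> = (\<lambda>(v, t). if t \<le> m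
     then walks (t - 1) v v * ballot (2 * int v - int t) (m - t) (u - int v)
            * bc (m - t) (\<mu> - int v - 1)
     else 0)"

text \<open>For a past exit, Pascal's rule in both factors gives the four terms; the extra term is
  an exit at the new last step.\<close>

lemma bad_Suc:
  assumes "(v, t) \<in> exits k" "int (Suc m) \<le> 2 * u"
  shows "bad (Suc m) u \<mu> (v, t) = bad m u \<mu> (v, t) + bad m u (\<mu> - 1) (v, t)
           + bad m (u - 1) \<mu> (v, t) + bad m (u - 1) (\<mu> - 1) (v, t)
           + (if (v, t) = (nat u, Suc m) then if \<mu> = u + 1 then walks m u u else 0 else 0)"
proof -
  have t: "v < t" "t \<le> 2 * v" using assms by (auto simp: exits_def)
  consider "t \<le> m" | "t = Suc m" | "t > Suc m" by linarith
  then show ?thesis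
  proof cases
    case 1
    then have s: "Suc m - t = Suc (m - t)" by simp
    show ?thesis using 1
      unfolding bad_def s by (simp add: s ballot_Suc bc_Suc algebra_simps)
  next
    case 2
    \<comment> \<open>No steps remain, and \<open>t\<close> is at most \<open>2 * v\<close> and
      \<open>2 * u\<close>, so the reflected index is positive.\<close>
    then show ?thesis using assms(2) t
      by (auto simp: bad_def ballot_def bc_0)
  qed (auto simp: bad_def)
qed

text \<open>Both sides obey the same recurrence. Height -1 is included because the recurrence
  reaches it from height 0 or 1; \<open>\<mu> \<le> int k\<close> puts every relevant exit into
  \<open>exits k\<close>.\<close>

lemma walks_eq:
  assumes "int m \<le> 2 * u + 1" "\<mu> \<le> int k"
  shows "walks m u \<mu> = ballot 0 m u * bc m \<mu> - (\<Sum>e\<in>exits k. bad m u \<mu> e)"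
  using assms
proof (induction m arbitrary: u \<mu>)
  case 0
  have "bad 0 u \<mu> e = 0" if "e \<in> exits k" for e
    using that by (auto simp: bad_def exits_def)
  then show ?case using 0 by (auto simp: walks_0 ballot_def bc_0)
next
  case (Suc m)
  show ?case
  proof (cases "int (Suc m) \<le> 2 * u")
    case False
    then have u: "2 * u + 1 = int (Suc m)" using Suc.prems by simp
    \<comment> \<open>The final height is -1, so all ballot factors vanish.\<close>
    have "bad (Suc m) u \<mu> e = 0" for e
      using u by (auto simp: bad_def of_nat_diff intro!: ballot_eq_0 split: prod.split)
    moreover have "ballot 0 (Suc m) u = 0" using u by (intro ballot_eq_0) simp
    moreover have "walks (Suc m) u \<mu> = 0" using u by (intro walks_eq_0) simp
    ultimately show ?thesis by simp
  next
    case True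
    let ?new = "if \<mu> = u + 1 then walks m u u else 0"
    have "(\<Sum>e\<in>exits k. if e = (nat u, Suc m) then ?new else 0)
            = (if (nat u, Suc m) \<in> exits k then ?new else 0)"
      by (rule sum.delta) simp
    \<comment> \<open>If \<open>?new\<close> is nonzero, then \<open>u < k\<close> by
      \<open>\<mu> = u + 1\<close>, and \<open>u \<le> m\<close>, so the pair is an exit.\<close>
    also have "\<dots> = ?new"
      using True Suc.prems walks_eq_0[of u m u] by (auto simp: exits_def)
    finally have new: "(\<Sum>e\<in>exits k. if e = (nat u, Suc m) then ?new else 0) = ?new" .
    have "(\<Sum>e\<in>exits k. bad (Suc m) u \<mu> e) =
        (\<Sum>e\<in>exits k. bad m u \<mu> e + bad m u (\<mu> - 1) e + bad m (u - 1) \<mu> e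
           + bad m (u - 1) (\<mu> - 1) e + (if e = (nat u, Suc m) then ?new else 0))"
      by (intro sum.cong refl) (use True bad_Suc in force)
    then have B: "(\<Sum>e\<in>exits k. bad (Suc m) u \<mu> e) =
        (\<Sum>e\<in>exits k. bad m u \<mu> e) + (\<Sum>e\<in>exits k. bad m u (\<mu> - 1) e)
        + (\<Sum>e\<in>exits k. bad m (u - 1) \<mu> e) + (\<Sum>e\<in>exits k. bad m (u - 1) (\<mu> - 1) e) + ?new"
      unfolding sum.distrib new .
    \<comment> \<open>For \<open>\<mu> = u + 1\<close> the left side is 0 but
      \<open>walks m u u\<close> survives on the right; \<open>?new\<close> removes it.\<close>
    have "walks (Suc m) u \<mu> = walks m u \<mu> + walks m u (\<mu> - 1)
            + walks m (u - 1) \<mu> + walks m (u - 1) (\<mu> - 1) - ?new"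
    proof (cases "\<mu> \<le> u")
      case False
      then show ?thesis by (auto simp: walks_eq_0)
    qed (use True walks_Suc in auto)
    also have "\<dots> = ballot 0 (Suc m) u * bc (Suc m) \<mu> - (\<Sum>e\<in>exits k. bad (Suc m) u \<mu> e)"
      using True Suc.prems by (simp add: Suc.IH B ballot_Suc bc_Suc algebra_simps)
    finally show ?thesis .
  qed
qed


text \<open>The bound ensures \<open>t \<le> 2 * N\<close> for all exits, yet admits
  \<open>k = N + 1\<close>, whose end point (0, -1) yields the zero in
  \<open>count_poly_0\<close>.\<close>

lemma F_axis:
  assumes "k \<le> Suc N"
  shows "int (F (2 * N) 0 (int N - int k)) = ballot 0 (2 * N) (int N) * int (2 * N choose k)
     - (\<Sum>(v, t)\<in>exits k. walks (t - 1) v v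
          * (ballot (int (2 * v - t)) (2 * N - t) (int (N - v)) * int (2 * N - t choose (k - 1 - v))))"
proof -
  have "bad (2 * N) (int N) (int k) e = (case e of (v, t) \<Rightarrow> walks (t - 1) v v
          * (ballot (int (2 * v - t)) (2 * N - t) (int (N - v)) * int (2 * N - t choose (k - 1 - v))))"
    if "e \<in> exits k" for e
  proof -
    obtain v t where e: "e = (v, t)" by fastforce
    with that have vt: "v < k" "v < t" "t \<le> 2 * v" by (auto simp: exits_def)
    then have "int k - int v - 1 = int (k - 1 - v)" "int N - int v = int (N - v)"
      "2 * int v - int t = int (2 * v - t)" "t \<le> 2 * N"
      using assms by auto
    then show ?thesis by (simp only: e bad_def bc_of_nat prod.case if_True mult.assoc)
  qed
  then have "(\<Sum>e\<in>exits k. bad (2 * N) (int N) (int k) e) = (\<Sum>(v, t)\<in>exits k. walks (t - 1) v v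
          * (ballot (int (2 * v - t)) (2 * N - t) (int (N - v)) * int (2 * N - t choose (k - 1 - v))))"
    by (intro sum.cong) auto
  moreover have "int (F (2 * N) 0 (int N - int k)) = walks (2 * N) (int N) (int k)"
    by (simp add: walks_def)
  ultimately show ?thesis by (simp add: walks_eq[where k = k] bc_of_nat)
qed

section \<open>Polynomial form of the count\<close>

text \<open>The polynomial in \<open>m\<close> for a ballot number from height \<open>e\<close> with \<open>m + p\<close> up steps, times the
  number of ways to place \<open>r\<close> marks, see \<open>ballot_choose_eq_poly\<close>. The main term of the count has
  \<open>e = c = 0\<close>; for the exit \<open>(v, t)\<close> one has \<open>e = 2v - t\<close> and \<open>c = t - v\<close>, so that
  \<open>p + e + c = k - 1\<close> always.\<close>

definition path_poly :: "nat \<Rightarrow> nat \<Rightarrow> nat \<Rightarrow> nat \<Rightarrow> rat poly" where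
  "path_poly p e c r = (\<Prod>i<p. [:of_nat (4 * i + 2), 4:]) * (\<Prod>i<e. [:of_nat (2 * p + 1 + i), 2:])
     * (\<Prod>i<c. [:of_nat (p + e + 2 + i), 1:])
     * smult (1 / fact r) (\<Prod>i<r. [:of_nat (2 * p + e) - of_nat i, 2:])"

lemma degree_path_poly: "degree (path_poly p e c r) = p + e + c + r"
  by (simp add: path_poly_def degree_mult_eq degree_prod_sum_eq)

lemma poly_path_poly:
  "poly (path_poly p e c r) x = (\<Prod>i<p. of_nat (4 * i + 2) + x * 4)
     * (\<Prod>i<e. of_nat (2 * p + 1 + i) + x * 2) * (\<Prod>i<c. of_nat (p + e + 2 + i) + x)
     * ((\<Prod>i<r. of_nat (2 * p + e) - of_nat i + x * 2) / fact r)"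
  by (simp add: path_poly_def poly_prod)

lemma fact_add_prod: "(fact (a + n) :: rat) = fact a * (\<Prod>i<n. of_nat (a + 1 + i))"
  by (induction n) (auto simp: algebra_simps)

text \<open>Raising \<open>p\<close> by one brings in (2m + 2p + 1)(2m + 2p + 2); division by m + p
  + 1 leaves 4m + 4p + 2.\<close>

lemma fact_double_prod:
  "(fact (2 * m + 2 * p) :: rat) * fact m
     = fact (2 * m) * fact (m + p) * (\<Prod>i<p. of_nat (4 * i + 2) + of_nat m * 4)"
proof (induction p)
  case (Suc p)
  have "(fact (2 * m + 2 * Suc p) :: rat)
          = 2 * of_nat (m + p + 1) * of_nat (2 * m + 2 * p + 1) * fact (2 * m + 2 * p)"
    by (simp add: algebra_simps)
  then have "(fact (2 * m + 2 * Suc p) :: rat) * fact m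
          = 2 * of_nat (m + p + 1) * of_nat (2 * m + 2 * p + 1) * (fact (2 * m + 2 * p) * fact m)"
    by simp
  also have "\<dots> = fact (2 * m) * (of_nat (m + p + 1) * fact (m + p))
      * ((\<Prod>i<p. of_nat (4 * i + 2) + of_nat m * 4) * (2 * of_nat (2 * m + 2 * p + 1)))"
    unfolding Suc.IH by (simp only: mult_ac)
  also have "of_nat (m + p + 1) * fact (m + p) = (fact (m + Suc p) :: rat)"
    by simp
  also have "2 * of_nat (2 * m + 2 * p + 1) = (of_nat (4 * p + 2) + of_nat m * 4 :: rat)"
    by simp
  finally show ?case by simp
qed simp

text \<open>The products in \<open>path_poly\<close> are factorial quotients; the one of length
  \<open>c\<close> only raises (m + p + e + 1)! to the common denominator.\<close>

lemma ballot_choose_eq_poly: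
  "(of_int (ballot (int e) (2 * m + 2 * p + e) (int (m + p))) :: rat)
       * of_nat (2 * m + 2 * p + e choose r)
     = fact (2 * m) / (fact m * fact (m + p + e + c + 1))
         * (of_nat (e + 1) * poly (path_poly p e c r) (of_nat m))"
proof -
  let ?P = "\<Prod>i<p. of_nat (4 * i + 2) + of_nat m * 4 :: rat"
  let ?E = "\<Prod>i<e. of_nat (2 * p + 1 + i) + of_nat m * 2 :: rat"
  let ?C = "\<Prod>i<c. of_nat (p + e + 2 + i) + of_nat m :: rat"
  let ?R = "(\<Prod>i<r. of_nat (2 * p + e) - of_nat i + of_nat m * 2) / fact r :: rat"
  have P: "?P = fact (2 * m + 2 * p) * fact m / (fact (2 * m) * fact (m + p))"
    using fact_double_prod[of m p] by (simp add: field_simps)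
  have E: "?E = fact (2 * m + 2 * p + e) / fact (2 * m + 2 * p)"
    unfolding fact_add_prod[of "2 * m + 2 * p"]
    by (simp del: fact_Suc) (intro prod.cong refl, simp)
  have C: "?C = fact (m + p + e + c + 1) / fact (m + p + e + 1)"
  proof -
    have "?C = (\<Prod>i<c. of_nat (m + p + e + 1 + 1 + i))"
      by (intro prod.cong refl) simp
    moreover have "m + p + e + c + 1 = m + p + e + 1 + c" by simp
    ultimately show ?thesis using fact_add_prod[of "m + p + e + 1" c] by (simp del: fact_Suc)
  qed
  have R: "of_nat (2 * m + 2 * p + e choose r) = ?R"
    unfolding binomial_gbinomial gbinomial_prod_rev atLeast0LessThan by (simp add: algebra_simps)
  have B: "(of_int (ballot (int e) (2 * m + 2 * p + e) (int (m + p))) :: rat)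
      = of_nat (e + 1) * fact (2 * m + 2 * p + e) / (fact (m + p) * fact (m + p + e + 1))"
    by (subst ballot_fact[where b = "m + p + e + 1"]) auto
  show ?thesis
    unfolding poly_path_poly P E C R B by (simp add: divide_simps del: fact_Suc)
qed

text \<open>Here k = l + 1 and N = m + l; after the exit \<open>(v, t)\<close> there remain
  \<open>l - v\<close> marks to place.\<close>

definition count_poly :: "nat \<Rightarrow> rat poly" where
  "count_poly l = path_poly l 0 0 (Suc l) - (\<Sum>(v, t)\<in>exits (Suc l).
     smult (of_int (walks (t - 1) v v) * of_nat (2 * v - t + 1))
       (path_poly (l - v) (2 * v - t) (t - v) (l - v)))"

lemma F_eq_poly:
  "(of_nat (F (2 * (m + l)) 0 (int m - 1)) :: rat)
     = fact (2 * m) / (fact m * fact (m + l + 1)) * poly (count_poly l) (of_nat m)"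
proof -
  let ?D = "fact (2 * m) / (fact m * fact (m + l + 1)) :: rat"
  have main: "(of_int (ballot 0 (2 * (m + l)) (int (m + l))) :: rat) * of_nat (2 * (m + l) choose Suc l)
      = ?D * poly (path_poly l 0 0 (Suc l)) (of_nat m)"
    using ballot_choose_eq_poly[of 0 m l "Suc l" 0] by (simp add: algebra_simps)
  have exit: "(of_int (ballot (int (2 * v - t)) (2 * (m + l) - t) (int (m + l - v))) :: rat)
        * of_nat (2 * (m + l) - t choose (l - v))
      = ?D * (of_nat (2 * v - t + 1) * poly (path_poly (l - v) (2 * v - t) (t - v) (l - v)) (of_nat m))"
    if "(v, t) \<in> exits (Suc l)" for v t
  proof -
    have vt: "v \<le> l" "v < t" "t \<le> 2 * v" using that by (auto simp: exits_def)
    then have "2 * (m + l) - t = 2 * m + 2 * (l - v) + (2 * v - t)" "m + l - v = m + (l - v)"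
      "m + l + 1 = m + (l - v) + (2 * v - t) + (t - v) + 1"
      by auto
    then show ?thesis by (simp only: ballot_choose_eq_poly)
  qed
  have "int m - 1 = int (m + l) - int (Suc l)" by simp
  then have "(of_nat (F (2 * (m + l)) 0 (int m - 1)) :: rat)
      = of_int (int (F (2 * (m + l)) 0 (int (m + l) - int (Suc l))))"
    by simp
  also have "\<dots> = of_int (ballot 0 (2 * (m + l)) (int (m + l))) * of_nat (2 * (m + l) choose Suc l)
      - (\<Sum>(v, t)\<in>exits (Suc l). of_int (walks (t - 1) v v)
          * (of_int (ballot (int (2 * v - t)) (2 * (m + l) - t) (int (m + l - v)))
             * of_nat (2 * (m + l) - t choose (l - v))))"
    by (subst F_axis) (simp_all add: case_prod_unfold)
  also have "(\<Sum>(v, t)\<in>exits (Suc l). of_int (walks (t - 1) v v)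
          * (of_int (ballot (int (2 * v - t)) (2 * (m + l) - t) (int (m + l - v)))
             * of_nat (2 * (m + l) - t choose (l - v))))
      = (\<Sum>(v, t)\<in>exits (Suc l). of_int (walks (t - 1) v v)
          * (?D * (of_nat (2 * v - t + 1) * poly (path_poly (l - v) (2 * v - t) (t - v) (l - v)) (of_nat m))))"
    by (intro sum.cong refl) (use exit in force)
  finally show ?thesis
    unfolding main count_poly_def
    by (simp add: poly_sum case_prod_unfold right_diff_distrib sum_distrib_left mult_ac)
qed

text \<open>An exit contributes degree at most 2l - v, below the 2l + 1 of the main term.\<close>

lemma degree_count_poly: "degree (count_poly l) = 2 * l + 1"
proof -
  have "degree (\<Sum>(v, t)\<in>exits (Suc l).
     smult (of_int (walks (t - 1) v v) * of_nat (2 * v - t + 1))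
       (path_poly (l - v) (2 * v - t) (t - v) (l - v))) \<le> 2 * l"
  proof (rule degree_sum_le)
    fix e assume "e \<in> exits (Suc l)"
    then show "degree (case e of (v, t) \<Rightarrow>
        smult (of_int (walks (t - 1) v v) * of_nat (2 * v - t + 1))
          (path_poly (l - v) (2 * v - t) (t - v) (l - v))) \<le> 2 * l"
      by (auto simp: exits_def degree_path_poly intro: order_trans[OF degree_smult_le])
  qed simp
  then have "degree (count_poly l) = degree (path_poly l 0 0 (Suc l))"
    unfolding count_poly_def diff_conv_add_uminus
    by (intro degree_add_eq_left) (simp add: degree_path_poly)
  then show ?thesis by (simp add: degree_path_poly)
qed

lemma count_poly_0: "poly (count_poly l) 0 = 0"
  using F_eq_poly[of 0 l] by (simp add: F_neg)

section \<open>Passage to Pochhammer symbols\<close>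

lemma pochhammer_3_2: "4 ^ n * (pochhammer (3/2) n :: rat) = fact (2 * n + 1) / fact n"
proof (induction n)
  case (Suc n)
  have "4 ^ Suc n * (pochhammer (3/2) (Suc n) :: rat)
      = 4 ^ n * pochhammer (3/2) n * (2 * (2 * of_nat n + 3))"
    by (simp add: pochhammer_Suc algebra_simps)
  also have "\<dots> = fact (2 * Suc n + 1) / fact (Suc n)"
    unfolding Suc.IH by (simp add: divide_simps) (simp add: algebra_simps)
  finally show ?case .
qed simp

lemma pochhammer_add_2: "pochhammer (of_nat k + 2 :: rat) n = fact (n + k + 1) / fact (k + 1)"
proof (induction n)
  case (Suc n)
  have "(fact (Suc n + k + 1) :: rat) = fact (n + k + 1) * (of_nat k + 2 + of_nat n)"
    by (simp add: algebra_simps)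
  then show ?case by (simp add: pochhammer_Suc Suc.IH del: fact_Suc)
qed (simp del: fact_Suc)

text \<open>Substitutes m = n + 1. The 2 comes from (2n + 2)!/(n + 1)! = 2 (2n + 1)!/n!, the (k +
  1)! from \<open>pochhammer_add_2\<close>.\<close>

definition coeff_poly :: "nat \<Rightarrow> rat poly" where
  "coeff_poly k = smult (2 / fact (k + 1)) (pcompose (count_poly (k - 1)) [:1, 1:])"

lemma F_eq_coeff_poly:
  assumes "1 \<le> k"
  shows "(of_nat (F (2 * n + 2 * k) 0 (int n)) :: rat)
    = 4 ^ n * (pochhammer (3/2) n / pochhammer (of_nat k + 2) n) * poly (coeff_poly k) (of_nat n)"
proof -
  obtain l where k: "k = Suc l" using assms by (cases k) auto
  have "2 * n + 2 * k = 2 * (Suc n + l)" "int n = int (Suc n) - 1" by (auto simp: k)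
  then have "(of_nat (F (2 * n + 2 * k) 0 (int n)) :: rat)
      = fact (2 * Suc n) / (fact (Suc n) * fact (Suc n + l + 1)) * poly (count_poly l) (of_nat (Suc n))"
    by (simp only: F_eq_poly)
  also have "fact (2 * Suc n) / (fact (Suc n) * fact (Suc n + l + 1))
      = 2 * fact (2 * n + 1) / (fact n * (fact (n + k + 1) :: rat))"
    by (simp add: k divide_simps)
  also have "poly (count_poly l) (of_nat (Suc n)) = poly (coeff_poly k) (of_nat n) * fact (k + 1) / 2"
    by (simp add: coeff_poly_def k poly_pcompose)
  finally show ?thesis
    by (simp add: times_divide_eq_right pochhammer_3_2 pochhammer_add_2 field_simps del: fact_Suc)
qed

lemma coeff_poly_props:
  assumes "1 \<le> k"
  shows "degree (coeff_poly k) = 2 * k - 1" "[:1, 1:] dvd coeff_poly k"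
proof -
  show "degree (coeff_poly k) = 2 * k - 1"
    using assms by (simp add: coeff_poly_def degree_pcompose degree_count_poly)
  have "poly (coeff_poly k) (-1) = 0"
    by (simp add: coeff_poly_def poly_pcompose count_poly_0)
  then show "[:1, 1:] dvd coeff_poly k"
    by (simp add: poly_eq_0_iff_dvd)
qed

text \<open>Without marks there are no exits, which leaves the Catalan number.\<close>

lemma F_0_axis: "(of_nat (F (2 * n) 0 (int n)) :: rat) = fact (2 * n) / (fact n * fact (n + 1))"
proof -
  have "int (F (2 * n) 0 (int n)) = ballot 0 (2 * n) (int n)"
    using F_axis[of 0 n] by (simp add: exits_def)
  then have "(of_nat (F (2 * n) 0 (int n)) :: rat) = of_int (ballot 0 (2 * n) (int n))"
    by (metis of_int_of_nat_eq)
  also have "\<dots> = fact (2 * n) / (fact n * fact (n + 1))"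
    by (subst ballot_fact[where b = "n + 1"]) auto
  finally show ?thesis .
qed

lemma F_0_axis_pochhammer:
  "(of_nat (F (2 * n) 0 (int n)) :: rat)
     = 4 ^ n * (pochhammer (3/2) n / ((2 * of_nat n + 1) * pochhammer 2 n))"
proof -
  have "(fact (2 * n + 1) :: rat) = (2 * of_nat n + 1) * fact (2 * n)" by simp
  moreover have "(2 * of_nat n + 1 :: rat) \<noteq> 0"
    by (metis of_nat_1 of_nat_add of_nat_mult of_nat_numeral of_nat_neq_0 Suc_eq_plus1)
  moreover have "pochhammer 2 n = (fact (n + 1) :: rat)"
    using pochhammer_add_2[of 0 n] by simp
  ultimately show ?thesis
    by (simp add: F_0_axis times_divide_eq_right pochhammer_3_2 del: fact_Suc)
qed

lemma pochhammer_half: "pochhammer (3/2 :: rat) n = (2 * of_nat n + 1) * pochhammer (1/2) n"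
  by (induction n) (simp_all add: pochhammer_Suc field_simps)

section \<open>Explicit polynomials for k = 1, 2, 3\<close>

lemma exits_1: "exits (Suc 0) = {}"
  and exits_2: "exits (Suc (Suc 0)) = {(1, 2)}"
  and exits_3: "exits (Suc (Suc (Suc 0))) = {(1, 2), (2, 3), (2, 4)}"
  by (auto simp: exits_def lessThan_Suc)

lemma coeff_poly_1: "poly (coeff_poly 1) x = 2 * (x + 1)"
  by (simp add: coeff_poly_def count_poly_def exits_1 poly_pcompose poly_path_poly algebra_simps)

lemma coeff_poly_2: "poly (coeff_poly 2) x = (x + 1) * (8 * x ^ 2 + 32 * x + 33) / 3"
proof -
  have "walks 1 1 1 = 1" by (simp add: walks_def F_Suc F_0)
  then show ?thesis
    by (simp add: coeff_poly_def count_poly_def exits_2 poly_pcompose poly_path_poly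
      fact_numeral lessThan_Suc field_simps power2_eq_square)
qed

lemma coeff_poly_3:
  "poly (coeff_poly 3) x
     = (x + 1) * (64 * x ^ 4 + 672 * x ^ 3 + 2648 * x ^ 2 + 4641 * x + 3060) / 36"
proof -
  \<comment> \<open>The prefix counts \<open>walks (t - 1) v v\<close> of the exits (1, 2), (2, 3)
    and (2, 4).\<close>
  have "walks 1 1 1 = 1" "walks 2 2 2 = 1" "walks 3 2 2 = 5"
    by (simp_all add: walks_def numeral_2_eq_2 numeral_3_eq_3 F_Suc F_0)
  then show ?thesis
    by (simp add: coeff_poly_def count_poly_def exits_3 poly_pcompose poly_path_poly numeral_2_eq_2
      fact_numeral lessThan_Suc field_simps power2_eq_square power3_eq_cube power4_eq_xxxx)
qed


theorem corollary4:
  shows "(\<forall>n::nat.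
            (of_nat (F (2*n) 0 (int n)) :: rat)
              = 4^n * (pochhammer (3/2) n / ((2 * of_nat n + 1) * pochhammer 2 n)) \<and>
            4^n * (pochhammer (3/2) n / ((2 * of_nat n + 1) * pochhammer 2 n))
              = (4^n * pochhammer (1/2) n / pochhammer 2 n :: rat)) \<and>
         (\<forall>n::nat.
            (of_nat (F (2*n + 2) 0 (int n)) :: rat)
              = 2^(2*n + 1) * (of_nat n + 1) * pochhammer (3/2) n / pochhammer 3 n) \<and>
         (\<forall>n::nat.
            (of_nat (F (2*n + 4) 0 (int n)) :: rat)
              = 4^n * (of_nat n + 1) * (8 * of_nat n ^ 2 + 32 * of_nat n + 33)
                  * pochhammer (3/2) n / (3 * pochhammer 4 n)) \<and>
         (\<forall>n::nat.
            (of_nat (F (2*n + 6) 0 (int n)) :: rat)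
              = 4 powi (int n - 1) * (of_nat n + 1)
                  * (64 * of_nat n ^ 4 + 672 * of_nat n ^ 3 + 2648 * of_nat n ^ 2
                      + 4641 * of_nat n + 3060)
                  * pochhammer (3/2) n / (9 * pochhammer 5 n)) \<and>
         (\<exists>r :: nat \<Rightarrow> nat \<Rightarrow> rat.
            (\<forall>k n. of_nat (F (2*n + 2*k) 0 (int n))
               = 4^n * (pochhammer (3/2) n / pochhammer (of_nat k + 2) n) * r k n) \<and>
            (\<forall>n. r 0 n = 1 / (2 * of_nat n + 1)) \<and>
            (\<forall>k\<ge>1. \<exists>p :: rat poly.
               (\<forall>n. r k n = poly p (of_nat n)) \<and> degree p = 2*k - 1 \<and> [:1, 1:] dvd p))"
proof (intro conjI allI)
  fix n :: nat
  show "(of_nat (F (2*n) 0 (int n)) :: rat)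
          = 4^n * (pochhammer (3/2) n / ((2 * of_nat n + 1) * pochhammer 2 n))"
    by (rule F_0_axis_pochhammer)
  show "4^n * (pochhammer (3/2) n / ((2 * of_nat n + 1) * pochhammer 2 n))
          = (4^n * pochhammer (1/2) n / pochhammer 2 n :: rat)"
    by (simp add: pochhammer_half)
  show "(of_nat (F (2*n + 2) 0 (int n)) :: rat)
          = 2^(2*n + 1) * (of_nat n + 1) * pochhammer (3/2) n / pochhammer 3 n"
    using F_eq_coeff_poly[of 1 n] unfolding coeff_poly_1 by (simp add: power_mult)
  show "(of_nat (F (2*n + 4) 0 (int n)) :: rat)
          = 4^n * (of_nat n + 1) * (8 * of_nat n ^ 2 + 32 * of_nat n + 33)
              * pochhammer (3/2) n / (3 * pochhammer 4 n)"
    using F_eq_coeff_poly[of 2 n] unfolding coeff_poly_2 by (simp add: mult_ac)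
  show "(of_nat (F (2*n + 6) 0 (int n)) :: rat)
          = 4 powi (int n - 1) * (of_nat n + 1)
              * (64 * of_nat n ^ 4 + 672 * of_nat n ^ 3 + 2648 * of_nat n ^ 2
                  + 4641 * of_nat n + 3060)
              * pochhammer (3/2) n / (9 * pochhammer 5 n)"
  proof -
    \<comment> \<open>The exponent is -1 at n = 0; the factor 1/4 turns the 9 into the 36 of
      \<open>coeff_poly_3\<close>.\<close>
    have "4 powi (int n - 1) = (4 ^ n / 4 :: rat)"
      by (simp add: power_int_diff)
    from F_eq_coeff_poly[of 3 n] show ?thesis
      unfolding coeff_poly_3 \<open>4 powi _ = _\<close> by (simp add: mult_ac)
  qed
next
  let ?r = "\<lambda>k n. if k = 0 then 1 / (2 * of_nat n + 1) else poly (coeff_poly k) (of_nat n) :: rat"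
  have "of_nat (F (2*n + 2*k) 0 (int n))
          = 4^n * (pochhammer (3/2) n / pochhammer (of_nat k + 2) n) * ?r k n" for k n
    using F_0_axis_pochhammer[of n] F_eq_coeff_poly[of k n] by (cases "k = 0") auto
  then show "\<exists>r :: nat \<Rightarrow> nat \<Rightarrow> rat.
            (\<forall>k n. of_nat (F (2*n + 2*k) 0 (int n))
               = 4^n * (pochhammer (3/2) n / pochhammer (of_nat k + 2) n) * r k n) \<and>
            (\<forall>n. r 0 n = 1 / (2 * of_nat n + 1)) \<and>
            (\<forall>k\<ge>1. \<exists>p :: rat poly.
               (\<forall>n. r k n = poly p (of_nat n)) \<and> degree p = 2*k - 1 \<and> [:1, 1:] dvd p)"
    using coeff_poly_props by (intro exI[of _ ?r]) auto
qed

end
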